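(* Let $D=(V,A)$ be an oriented graph and let $v_0\in V$ be a vertex adjacent to all other vertices of $D$ (i.e. for every $u\in V\setminus\{v_0\}$, exactly one of $v_0u$, $uv_0$ is an arc). Let $a=\min\{d^+(v): v\in N^+(v_0)\}$ and $b=\min\{d^+(v): v\in N^-(v_0)\}$. If $d^+(v_0)\le \min\bigl(a,\tfrac12(a+b+1)\bigr)$, then $v_0$ belongs to $d^+(v_0)$ pairwise arc-disjoint (directed) cycles of $D$.
   Context: An oriented graph is a finite digraph without loops, multiple arcs, or pairs of opposite arcs. For a vertex $v$: $N^+(v)=\{u\in V\setminus\{v\}: vu\in A\}$, $N^-(v)=\{u\in V\setminus\{v\}: uv\in A\}$, and $d^+(v)=|N^+(v)|$. *)

theory Defs
  imports Complex_Main "Graph_Theory.Arc_Walk"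
begin

(* The library locale digraph is finite, without loops and without multiple arcs. *)
locale oriented_graph = digraph G for G :: "('a, 'b) pre_digraph" (structure) +
  assumes no_opposite_arcs: "u \<rightarrow> v \<Longrightarrow> \<not> v \<rightarrow> u"

definition out_nbrs :: "('a, 'b) pre_digraph \<Rightarrow> 'a \<Rightarrow> 'a set" where
  "out_nbrs G v = {u \<in> verts G - {v}. v \<rightarrow>\<^bsub>G\<^esub> u}"

definition in_nbrs :: "('a, 'b) pre_digraph \<Rightarrow> 'a \<Rightarrow> 'a set" where
  "in_nbrs G v = {u \<in> verts G - {v}. u \<rightarrow>\<^bsub>G\<^esub> v}"

definition out_deg :: "('a, 'b) pre_digraph \<Rightarrow> 'a \<Rightarrow> nat" where
  "out_deg G v = card (out_nbrs G v)"

(* Min of the empty set is unspecified.  When min_out_deg is applied to the out- and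
   in-neighbourhoods N+, N- of a vertex v0 adjacent to all others in an oriented graph,
   under the hypothesis d+(v0) <= min_out_deg N+, this is harmless:
   if N+ is empty then d+(v0) = 0 and there is no cycle to find; if N- is empty and N+
   is not, then every vertex of N+ has all its out-neighbours in N+, so some vertex of N+
   has out-degree less than |N+| = d+(v0) and the hypothesis fails. *)
definition min_out_deg :: "('a, 'b) pre_digraph \<Rightarrow> 'a set \<Rightarrow> nat" where
  "min_out_deg G S = Min (out_deg G ` S)"

(* A cycle is given, as in the library, by the list of its arcs from some starting vertex. *)
definition cycle_verts :: "('a, 'b) pre_digraph \<Rightarrow> 'b awalk \<Rightarrow> 'a set" where
  "cycle_verts G p = tail G ` set p \<union> head G ` set p"

(* Cycles are nonempty, so two rotations of one cycle, though different as lists, are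
   never arc-disjoint. *)
definition arc_disjoint :: "'b awalk \<Rightarrow> 'b awalk \<Rightarrow> bool" where
  "arc_disjoint p q \<longleftrightarrow> set p \<inter> set q = {}"

end

theory Submission
  imports Defs "HOL-Library.Transitive_Closure_Table"
begin

text \<open>Arc-disjoint cycles through \<open>v\<^sub>0\<close> are the cycles of a 0/1 circulation. By augmenting paths,
  some circulation uses all arcs leaving \<open>v\<^sub>0\<close> as soon as every set \<open>X\<close> avoiding \<open>v\<^sub>0\<close> is left by at
  least as many arcs as lead from \<open>v\<^sub>0\<close> into \<open>X\<close>. Let \<open>X\<close> contain \<open>p\<close> out-neighbours and \<open>q\<close>
  in-neighbours of \<open>v\<^sub>0\<close>. If \<open>q \<ge> p\<close>, the arcs from \<open>X\<close> to \<open>v\<^sub>0\<close> suffice. Otherwise the out-degrees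
  sum to at least \<open>pa + qb\<close> on \<open>X\<close>, at most \<open>(p + q)(p + q - 1)/2\<close> arcs stay inside \<open>X\<close>, and the
  hypothesis on \<open>d\<^sup>+(v\<^sub>0) \<ge> p\<close> leaves at least \<open>p\<close> arcs going out.\<close>

section \<open>Counting in finite sets, and paths under a changed relation\<close>

lemma card_filter_insert:
  assumes "finite F" "e \<notin> F"
  shows "card {x \<in> insert e F. P x} = card {x \<in> F. P x} + of_bool (P e)"
proof -
  have "{x \<in> insert e F. P x} = (if P e then insert e {x \<in> F. P x} else {x \<in> F. P x})"
    by auto
  then show ?thesis
    using assms by simp
qed

lemma card_filter_mem_eq_sum:
  assumes "finite F" "finite X"
  shows "card {e \<in> F. f e \<in> X} = (\<Sum>v\<in>X. card {e \<in> F. f e = v})"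
proof -
  have "{e \<in> F. f e \<in> X} = (\<Union>v\<in>X. {e \<in> F. f e = v})"
    by auto
  also have "card \<dots> = (\<Sum>v\<in>X. card {e \<in> F. f e = v})"
    using assms by (intro card_UN_disjoint) auto
  finally show ?thesis .
qed

text \<open>Augmenting changes the residual graph, so a path is carried over by comparing the two
  relations on its own vertices only.\<close>

lemma rtrancl_path_mono_on:
  assumes "rtrancl_path r x xs y"
    and "\<And>a b. a \<in> set (x # xs) \<Longrightarrow> b \<in> set xs \<Longrightarrow> r a b \<Longrightarrow> r' a b"
  shows "rtrancl_path r' x xs y"
  using assms
proof (induction rule: rtrancl_path.induct)
  case (step x y ys z)
  then show ?case
    by (intro rtrancl_path.step) auto
qed (rule rtrancl_path.base)

section \<open>Unit-capacity flows and augmenting paths\<close>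

context fin_digraph
begin

text \<open>A 0/1 flow is encoded by its set of used arcs. It sends one unit from \<open>s\<close>
  to \<open>t\<close>; for \<open>s = t\<close> the indicators cancel and it is a circulation. They
  are placed so that no subtraction of naturals occurs.\<close>

definition flow :: "'b set \<Rightarrow> 'a \<Rightarrow> 'a \<Rightarrow> bool" where
  "flow F s t \<longleftrightarrow> F \<subseteq> arcs G \<and>
     (\<forall>v. card {e \<in> F. head G e = v} + of_bool (v = s) = card {e \<in> F. tail G e = v} + of_bool (v = t))"

definition residual :: "'b set \<Rightarrow> 'a \<Rightarrow> 'a \<Rightarrow> bool" where
  "residual F u w \<longleftrightarrow>
     (\<exists>e\<in>arcs G. e \<notin> F \<and> tail G e = u \<and> head G e = w \<or> e \<in> F \<and> head G e = u \<and> tail G e = w)"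

lemma flow_finite: "flow F s t \<Longrightarrow> finite F"
  unfolding flow_def using finite_arcs finite_subset by blast

lemma flow_insert:
  assumes "flow F s (tail G e)" "e \<in> arcs G" "e \<notin> F"
  shows "flow (insert e F) s (head G e)"
  unfolding flow_def
proof (intro conjI allI)
  show "insert e F \<subseteq> arcs G"
    using assms by (auto simp: flow_def)
  fix v
  have "card {e \<in> F. head G e = v} + of_bool (v = s)
      = card {e \<in> F. tail G e = v} + of_bool (v = tail G e)"
    using assms by (auto simp: flow_def)
  then show "card {x \<in> insert e F. head G x = v} + of_bool (v = s)
      = card {x \<in> insert e F. tail G x = v} + of_bool (v = head G e)"
    using card_filter_insert[OF flow_finite[OF assms(1)] assms(3), of "\<lambda>x. head G x = v"]
      card_filter_insert[OF flow_finite[OF assms(1)] assms(3), of "\<lambda>x. tail G x = v"]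
    by (auto simp: eq_commute[of v])
qed

lemma flow_remove:
  assumes "flow F s (head G e)" "e \<in> F"
  shows "flow (F - {e}) s (tail G e)"
  unfolding flow_def
proof (intro conjI allI)
  show "F - {e} \<subseteq> arcs G"
    using assms by (auto simp: flow_def)
  fix v
  have "card {e \<in> F. head G e = v} + of_bool (v = s)
      = card {e \<in> F. tail G e = v} + of_bool (v = head G e)"
    using assms by (auto simp: flow_def)
  moreover have "finite (F - {e})" "insert e (F - {e}) = F"
    using flow_finite[OF assms(1)] assms(2) by auto
  ultimately show "card {x \<in> F - {e}. head G x = v} + of_bool (v = s)
      = card {x \<in> F - {e}. tail G x = v} + of_bool (v = tail G e)"
    using card_filter_insert[of "F - {e}" e "\<lambda>x. head G x = v"]
      card_filter_insert[of "F - {e}" e "\<lambda>x. tail G x = v"]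
    by (auto simp: eq_commute[of v] split: if_splits)
qed

lemma flow_residual_step:
  assumes "flow F s u" "residual F u w"
  obtains F' where "flow F' s w" "\<And>e. {tail G e, head G e} \<noteq> {u, w} \<Longrightarrow> e \<in> F' \<longleftrightarrow> e \<in> F"
proof -
  obtain e where e: "e \<in> arcs G"
    "e \<notin> F \<and> tail G e = u \<and> head G e = w \<or> e \<in> F \<and> head G e = u \<and> tail G e = w"
    using assms(2) by (auto simp: residual_def)
  from e(2) show thesis
  proof
    assume "e \<notin> F \<and> tail G e = u \<and> head G e = w"
    then show thesis
      using flow_insert[of F s e] assms(1) e(1) by (intro that[of "insert e F"]) auto
  next
    assume "e \<in> F \<and> head G e = u \<and> tail G e = w"
    then show thesis
      using flow_remove[of F s e] assms(1) by (intro that[of "F - {e}"]) auto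
  qed
qed

text \<open>The path has to be simple: pushing the flow over its first arc changes the residual graph,
  but only between the first two vertices.\<close>

lemma flow_residual_path:
  assumes "rtrancl_path (residual F) u xs w" "distinct (u # xs)" "s \<notin> set (u # xs)" "flow F s u"
  shows "\<exists>F'. flow F' s w \<and> (\<forall>e. tail G e = s \<or> head G e = s \<longrightarrow> (e \<in> F' \<longleftrightarrow> e \<in> F))"
  using assms
proof (induction xs arbitrary: u F)
  case Nil
  then show ?case
    by (auto elim: rtrancl_path.cases)
next
  case (Cons x xs)
  from Cons.prems(1) have ux: "residual F u x" and path: "rtrancl_path (residual F) x xs w"
    by (auto elim: rtrancl_path.cases)
  obtain F1 where F1: "flow F1 s x"
    and same: "\<And>e. {tail G e, head G e} \<noteq> {u, x} \<Longrightarrow> e \<in> F1 \<longleftrightarrow> e \<in> F"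
    using flow_residual_step[OF Cons.prems(4) ux] by metis
  have "rtrancl_path (residual F1) x xs w"
    using path
  proof (rule rtrancl_path_mono_on)
    fix a b assume "a \<in> set (x # xs)" "b \<in> set xs" "residual F a b"
    then obtain e where e: "e \<in> arcs G"
      "e \<notin> F \<and> tail G e = a \<and> head G e = b \<or> e \<in> F \<and> head G e = a \<and> tail G e = b"
      by (auto simp: residual_def)
    moreover have "{tail G e, head G e} \<noteq> {u, x}"
      using e(2) \<open>a \<in> set (x # xs)\<close> \<open>b \<in> set xs\<close> Cons.prems(2) by (auto simp: doubleton_eq_iff)
    ultimately show "residual F1 a b"
      using same unfolding residual_def by blast
  qed
  then obtain F' where F': "flow F' s w"
    "\<forall>e. tail G e = s \<or> head G e = s \<longrightarrow> (e \<in> F' \<longleftrightarrow> e \<in> F1)"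
    using Cons.IH[of F1 x] F1 Cons.prems(2,3) by auto
  moreover have "e \<in> F1 \<longleftrightarrow> e \<in> F" if "tail G e = s \<or> head G e = s" for e
    using same[of e] that Cons.prems(3) by (auto simp: doubleton_eq_iff)
  ultimately show ?case
    by blast
qed

text \<open>Summing conservation over \<open>X\<close> equates the number of arcs with tail in
  \<open>X\<close> and with head in \<open>X\<close>; the arcs inside \<open>X\<close> count on both
  sides and cancel.\<close>

lemma flow_balance_on:
  assumes "flow F s s" "finite X"
  shows "card {e \<in> F. tail G e \<in> X \<and> head G e \<notin> X} = card {e \<in> F. tail G e \<notin> X \<and> head G e \<in> X}"
proof -
  have fin: "finite F"
    using assms(1) by (rule flow_finite)
  have split: "card {e \<in> F. f e \<in> X} = card {e \<in> F. f e \<in> X \<and> g e \<in> X} + card {e \<in> F. f e \<in> X \<and> g e \<notin> X}"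
    for f g :: "'b \<Rightarrow> 'a"
  proof -
    have "{e \<in> F. f e \<in> X} = {e \<in> F. f e \<in> X \<and> g e \<in> X} \<union> {e \<in> F. f e \<in> X \<and> g e \<notin> X}"
      by auto
    also have "card \<dots> = card {e \<in> F. f e \<in> X \<and> g e \<in> X} + card {e \<in> F. f e \<in> X \<and> g e \<notin> X}"
      using fin by (intro card_Un_disjoint) auto
    finally show ?thesis .
  qed
  have "card {e \<in> F. tail G e \<in> X} = card {e \<in> F. head G e \<in> X}"
    using assms fin by (simp add: card_filter_mem_eq_sum flow_def)
  then show ?thesis
    using split[of "tail G" "head G"] split[of "head G" "tail G"] by (simp add: conj_commute)
qed

text \<open>A unit is sent along \<open>e0\<close>, the residual path and back by \<open>e1\<close>.
  The path avoids \<open>s\<close> and \<open>e1\<close> does not leave it, so \<open>e0\<close> is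
  the only new arc out of \<open>s\<close> and no old one is given up.\<close>

lemma flow_augment:
  assumes "flow F s s" "e0 \<in> arcs G" "e0 \<notin> F" "tail G e0 = s"
    and "(\<lambda>a b. residual F a b \<and> b \<noteq> s)\<^sup>*\<^sup>* (head G e0) (tail G e1)"
    and "head G e0 \<noteq> s" "e1 \<in> arcs G" "e1 \<notin> F" "tail G e1 \<noteq> s" "head G e1 = s"
  obtains F' where "flow F' s s" "{e \<in> F'. tail G e = s} = insert e0 {e \<in> F. tail G e = s}"
proof -
  let ?F = "insert e0 F"
  obtain xs where xs: "rtrancl_path (\<lambda>a b. residual F a b \<and> b \<noteq> s) (head G e0) xs (tail G e1)"
    "distinct (head G e0 # xs)"
    using assms(5) by (auto simp: rtranclp_eq_rtrancl_path elim: rtrancl_path_distinct)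
  have "s \<notin> set xs"
    using rtrancl_path_Range[OF xs(1), of s] by auto
  then have s: "s \<notin> set (head G e0 # xs)"
    using assms(6) by auto
  \<comment> \<open>Inserting \<open>e0\<close> changes only residual steps at \<open>s\<close>,
    which the path avoids.\<close>
  have "rtrancl_path (residual ?F) (head G e0) xs (tail G e1)"
    using xs(1)
  proof (rule rtrancl_path_mono_on)
    fix a b assume "a \<in> set (head G e0 # xs)" "b \<in> set xs" "residual F a b \<and> b \<noteq> s"
    then show "residual ?F a b"
      using s assms(4) unfolding residual_def by auto
  qed
  moreover have "flow ?F s (head G e0)"
    using flow_insert[of F s e0] assms by simp
  ultimately obtain F1 where F1: "flow F1 s (tail G e1)"
    "\<And>e. tail G e = s \<or> head G e = s \<Longrightarrow> (e \<in> F1 \<longleftrightarrow> e \<in> ?F)"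
    using flow_residual_path[OF _ xs(2) s] by blast
  have "e1 \<notin> F1"
    using F1(2) assms by auto
  then have "flow (insert e1 F1) s s"
    using flow_insert[of F1 s e1] F1(1) assms by simp
  moreover have "{e \<in> insert e1 F1. tail G e = s} = insert e0 {e \<in> F. tail G e = s}"
    using F1(2) assms by auto
  ultimately show thesis
    by (rule that)
qed

text \<open>If a circulation does not use all arcs leaving \<open>s\<close> and cannot be augmented, then
  the set reachable in its residual graph from the heads of the unused arcs violates the cut condition.\<close>

lemma saturating_circulation_exists:
  assumes loopfree: "\<And>e. e \<in> arcs G \<Longrightarrow> tail G e = s \<Longrightarrow> head G e \<noteq> s"
    and cut: "\<And>X. X \<subseteq> verts G - {s} \<Longrightarrow>
      card {e \<in> arcs G. tail G e = s \<and> head G e \<in> X} \<le> card {e \<in> arcs G. tail G e \<in> X \<and> head G e \<notin> X}"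
  obtains F where "flow F s s" "{e \<in> arcs G. tail G e = s} \<subseteq> F"
proof -
  define out where "out F = {e \<in> F. tail G e = s}" for F
  have out_le: "card (out F) \<le> card (arcs G)" if "flow F s s" for F
    using that by (intro card_mono) (auto simp: out_def flow_def)
  \<comment> \<open>A circulation with the most arcs out of \<open>s\<close> exists: the empty one
    is a candidate and the counts are bounded.\<close>
  have "\<exists>F. flow F s s \<and> (\<forall>F'. flow F' s s \<longrightarrow> card (out F') \<le> card (out F))"
  proof (rule Lattices_Big.ex_has_greatest_nat)
    show "flow {} s s"
      by (simp add: flow_def)
    show "\<forall>F. flow F s s \<longrightarrow> card (out F) < Suc (card (arcs G))"
      using out_le by (simp add: less_Suc_eq_le)
  qed
  then obtain F where F: "flow F s s" and max: "\<And>F'. flow F' s s \<Longrightarrow> card (out F') \<le> card (out F)"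
    by blast
  have finF: "finite F" and FG: "F \<subseteq> arcs G"
    using F flow_finite unfolding flow_def by blast+
  have "{e \<in> arcs G. tail G e = s} \<subseteq> F"
  proof (rule ccontr)
    assume "\<not> {e \<in> arcs G. tail G e = s} \<subseteq> F"
    then obtain e2 where e2: "e2 \<in> arcs G" "tail G e2 = s" "e2 \<notin> F"
      by auto
    \<comment> \<open>Entering \<open>s\<close> is excluded so that \<open>X\<close> avoids
      \<open>s\<close>, as the cut condition requires, and reachability yields paths fit for
      \<open>flow_augment\<close>.\<close>
    define R where "R = (\<lambda>a b. residual F a b \<and> b \<noteq> s)"
    define X where "X = {w. \<exists>e\<in>arcs G - F. tail G e = s \<and> R\<^sup>*\<^sup>* (head G e) w}"
    have step: "b \<in> X" if "a \<in> X" "residual F a b" "b \<noteq> s" for a b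
      using that unfolding X_def R_def by (auto intro: rtranclp.rtrancl_into_rtrancl)
    have start: "head G e \<in> X" if "e \<in> arcs G" "e \<notin> F" "tail G e = s" for e
      using that unfolding X_def by blast
    have R_verts: "R\<^sup>*\<^sup>* a b \<Longrightarrow> a \<in> verts G - {s} \<Longrightarrow> b \<in> verts G - {s}" for a b
      by (induction rule: rtranclp_induct) (auto simp: R_def residual_def)
    have X: "X \<subseteq> verts G - {s}"
    proof
      fix w assume "w \<in> X"
      then obtain e where "e \<in> arcs G" "tail G e = s" "R\<^sup>*\<^sup>* (head G e) w"
        by (auto simp: X_def)
      then show "w \<in> verts G - {s}"
        using R_verts loopfree by simp
    qed
    then have finX: "finite X"
      using finite_verts finite_subset by blast
    have noaug: "e \<in> F" if e: "e \<in> arcs G" "tail G e \<in> X" "head G e = s" for e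
    proof (rule ccontr)
      assume "e \<notin> F"
      from e(2) obtain e0 where e0: "e0 \<in> arcs G" "e0 \<notin> F" "tail G e0 = s" "R\<^sup>*\<^sup>* (head G e0) (tail G e)"
        by (auto simp: X_def)
      obtain F' where "flow F' s s" "out F' = insert e0 (out F)"
        using flow_augment[OF F e0(1-3) e0(4)[unfolded R_def]] loopfree[OF e0(1,3)] e \<open>e \<notin> F\<close> X
        unfolding out_def by blast
      moreover have "finite (out F)" "e0 \<notin> out F"
        using finF e0 by (auto simp: out_def)
      ultimately show False
        using max[of F'] by simp
    qed
    have "{e \<in> arcs G. tail G e \<in> X \<and> head G e \<notin> X} \<subseteq> {e \<in> F. tail G e \<in> X \<and> head G e \<notin> X}"
    proof safe
      fix e assume e: "e \<in> arcs G" "tail G e \<in> X" "head G e \<notin> X"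
      show "e \<in> F"
        using noaug[OF e(1,2)] step[OF e(2), of "head G e"] e by (auto simp: residual_def)
    qed
    then have "card {e \<in> arcs G. tail G e \<in> X \<and> head G e \<notin> X} \<le> card {e \<in> F. tail G e \<in> X \<and> head G e \<notin> X}"
      using finF by (intro card_mono) auto
    also have "\<dots> = card {e \<in> F. tail G e \<notin> X \<and> head G e \<in> X}"
      by (rule flow_balance_on[OF F finX])
    also have "{e \<in> F. tail G e \<notin> X \<and> head G e \<in> X} \<subset> {e \<in> arcs G. tail G e = s \<and> head G e \<in> X}"
    proof
      show "{e \<in> F. tail G e \<notin> X \<and> head G e \<in> X} \<subseteq> {e \<in> arcs G. tail G e = s \<and> head G e \<in> X}"
      proof safe
        fix e assume e: "e \<in> F" "tail G e \<notin> X" "head G e \<in> X"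
        then show "e \<in> arcs G"
          using FG by auto
        then show "tail G e = s"
          using step[OF e(3), of "tail G e"] e by (auto simp: residual_def)
      qed
      show "{e \<in> F. tail G e \<notin> X \<and> head G e \<in> X} \<noteq> {e \<in> arcs G. tail G e = s \<and> head G e \<in> X}"
        using e2 start[OF e2(1,3,2)] by auto
    qed
    then have "card {e \<in> F. tail G e \<notin> X \<and> head G e \<in> X} < card {e \<in> arcs G. tail G e = s \<and> head G e \<in> X}"
      using finite_arcs by (intro psubset_card_mono) auto
    finally show False
      using cut[OF X] by simp
  qed
  with F show thesis
    by (rule that)
qed

section \<open>Decomposing a circulation into arc-disjoint cycles\<close>

text \<open>Keeping the vertex list lets distinctness of the path pass to the walk, as
  \<open>cycle\<close> asks for it.\<close>

lemma awalk_of_rtrancl_path: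
  assumes "rtrancl_path (\<lambda>a b. \<exists>e\<in>F. tail G e = a \<and> head G e = b) u xs w" "u \<in> verts G" "F \<subseteq> arcs G"
  shows "\<exists>p. awalk u p w \<and> set p \<subseteq> F \<and> awalk_verts u p = u # xs"
  using assms
proof (induction rule: rtrancl_path.induct)
  case (base u)
  then show ?case
    by (intro exI[of _ "[]"]) (auto simp: awalk_Nil_iff)
next
  case (step u x xs w)
  then obtain e where e: "e \<in> F" "tail G e = u" "head G e = x"
    by auto
  then obtain p where "awalk x p w" "set p \<subseteq> F" "awalk_verts x p = x # xs"
    using step.IH step.prems wellformed(2) by blast
  then show ?case
    using e step.prems by (intro exI[of _ "e # p"]) (auto simp: awalk_Cons_iff)
qed

text \<open>Appending an arc moves the sink to its head, hence the induction from the right. The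
  arcs must be distinct because a flow is a set.\<close>

lemma flow_awalk:
  assumes "awalk u p v" "distinct p"
  shows "flow (set p) u v"
  using assms
proof (induction p arbitrary: v rule: rev_induct)
  case Nil
  then show ?case
    by (auto simp: awalk_Nil_iff flow_def)
next
  case (snoc e p)
  then have "awalk u p (tail G e)" "e \<in> arcs G" "head G e = v"
    by (auto simp: awalk_Cons_iff awalk_Nil_iff)
  then show ?case
    using snoc flow_insert[of "set p" u e] by simp
qed

lemma flow_diff:
  assumes "flow F s s" "flow P s s" "P \<subseteq> F"
  shows "flow (F - P) s s"
proof -
  have split: "card {e \<in> F. f e = v} = card {e \<in> P. f e = v} + card {e \<in> F - P. f e = v}"
    for f :: "'b \<Rightarrow> 'a" and v
  proof -
    have "{e \<in> F. f e = v} = {e \<in> P. f e = v} \<union> {e \<in> F - P. f e = v}"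
      using assms(3) by auto
    also have "card \<dots> = card {e \<in> P. f e = v} + card {e \<in> F - P. f e = v}"
      using assms(1,2) by (intro card_Un_disjoint) (auto dest: flow_finite)
    finally show ?thesis .
  qed
  show ?thesis
    using assms split[of "head G"] split[of "tail G"] by (auto simp: flow_def)
qed

text \<open>No arc of \<open>F\<close> leaves the set reachable along \<open>F\<close> from the head
  of \<open>e\<close>, so by balance none enters it. If \<open>s\<close> were outside,
  \<open>e\<close> would enter; so a simple path leads back to \<open>s\<close> and \<open>e\<close>
  closes it. By the last equation the cycle uses up just one arc out of \<open>s\<close>.\<close>

lemma circulation_cycle:
  assumes F: "flow F s s" and e: "e \<in> F" "tail G e = s"
  obtains p where "cycle p" "set p \<subseteq> F" "flow (set p) s s" "{x \<in> set p. tail G x = s} = {e}"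
proof -
  have FG: "F \<subseteq> arcs G"
    using F by (simp add: flow_def)
  define r where "r = (\<lambda>a b. \<exists>e\<in>F. tail G e = a \<and> head G e = b)"
  define X where "X = {w. r\<^sup>*\<^sup>* (head G e) w}"
  have "r\<^sup>*\<^sup>* a b \<Longrightarrow> a \<in> verts G \<Longrightarrow> b \<in> verts G" for a b
    by (induction rule: rtranclp_induct) (use FG in \<open>auto simp: r_def\<close>)
  then have "finite X"
    using e FG unfolding X_def by (intro finite_subset[OF _ finite_verts]) auto
  have "s \<in> X"
  proof (rule ccontr)
    assume "s \<notin> X"
    have "{x \<in> F. tail G x \<in> X \<and> head G x \<notin> X} = {}"
      unfolding X_def r_def by (auto intro: rtranclp.rtrancl_into_rtrancl)
    then have "card {x \<in> F. tail G x \<notin> X \<and> head G x \<in> X} = 0"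
      using flow_balance_on[OF F \<open>finite X\<close>] by (metis card.empty)
    then have "{x \<in> F. tail G x \<notin> X \<and> head G x \<in> X} = {}"
      using flow_finite[OF F] by simp
    then show False
      using e \<open>s \<notin> X\<close> by (auto simp: X_def)
  qed
  then obtain xs where xs: "rtrancl_path r (head G e) xs s" "distinct (head G e # xs)"
    by (auto simp: X_def rtranclp_eq_rtrancl_path elim: rtrancl_path_distinct)
  then obtain p where p: "awalk (head G e) p s" "set p \<subseteq> F" "awalk_verts (head G e) p = head G e # xs"
    using awalk_of_rtrancl_path[of F "head G e" xs s] e FG wellformed(2) unfolding r_def by blast
  have walk: "awalk s (e # p) s"
    using p(1) e FG by (auto simp: awalk_Cons_iff)
  have dist: "distinct (tl (awalk_verts s (e # p)))"
    using p(3) xs(2) by simp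
  \<comment> \<open>The vertex list of \<open>p\<close> is distinct and ends in \<open>s\<close>, so
    \<open>s\<close> does not occur earlier as a tail.\<close>
  have no_s: "tail G x \<noteq> s" if "x \<in> set p" for x
  proof -
    have "awalk_verts (head G e) p = map (tail G) p @ [s]"
      using p(1) awalk_verts_conv[of "head G e" p] that
      by (metis awalkE' awalk_verts_conv empty_iff empty_set last_snoc)
    then show ?thesis
      using p(3) xs(2) that by (metis distinct_append disjoint_iff list.set_intros(1) image_eqI list.set_map)
  qed
  show thesis
  proof (rule that)
    show "cycle (e # p)"
      using walk dist unfolding cycle_def by blast
    show "set (e # p) \<subseteq> F"
      using p e by simp
    show "flow (set (e # p)) s s"
      using walk dist by (intro flow_awalk distinct_tl_verts_imp_distinct)
    show "{x \<in> set (e # p). tail G x = s} = {e}"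
      using no_s e by auto
  qed
qed

text \<open>One cycle through \<open>s\<close> is removed at a time: what remains is a circulation
  with one arc fewer out of \<open>s\<close>, and its cycles avoid the removed arcs.\<close>

lemma circulation_disjoint_cycles:
  assumes "flow F s s" "card {e \<in> F. tail G e = s} = n"
  shows "\<exists>C. finite C \<and> card C = n \<and> (\<forall>p\<in>C. cycle p \<and> s \<in> cycle_verts G p \<and> set p \<subseteq> F)
    \<and> pairwise arc_disjoint C"
  using assms
proof (induction n arbitrary: F)
  case 0
  then show ?case
    by (intro exI[of _ "{}"]) auto
next
  case (Suc n)
  have fin: "finite F"
    using Suc.prems(1) by (rule flow_finite)
  obtain e where e: "e \<in> F" "tail G e = s"
    using card_eq_SucD[OF Suc.prems(2)] by auto
  obtain p where p: "cycle p" "set p \<subseteq> F" "flow (set p) s s" "{x \<in> set p. tail G x = s} = {e}"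
    using circulation_cycle[OF Suc.prems(1) e] by blast
  have "{x \<in> F - set p. tail G x = s} = {x \<in> F. tail G x = s} - {e}"
    using p(2,4) by auto
  then have "card {x \<in> F - set p. tail G x = s} = n"
    using Suc.prems(2) e fin by simp
  then obtain C where C: "finite C" "card C = n" "pairwise arc_disjoint C"
    "\<forall>q\<in>C. cycle q \<and> s \<in> cycle_verts G q \<and> set q \<subseteq> F - set p"
    using Suc.IH[OF flow_diff[OF Suc.prems(1) p(3,2)]] by blast
  have "e \<in> set p"
    using p(4) by auto
  \<comment> \<open>\<open>e\<close> lies on \<open>p\<close> but on no cycle in \<open>C\<close>,
    so inserting \<open>p\<close> really raises the cardinality.\<close>
  then have "p \<notin> C" "s \<in> cycle_verts G p"
    using C(4) e by (auto simp: cycle_verts_def)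
  moreover have "pairwise arc_disjoint (insert p C)"
    using C(3,4) by (auto simp: pairwise_insert arc_disjoint_def)
  ultimately show ?case
    using C p by (intro exI[of _ "insert p C"]) auto
qed

end

section \<open>Degree and arc counts, and the cut condition at \<open>v0\<close>\<close>

lemma (in digraph) out_deg_eq_card_arcs: "out_deg G v = card {e \<in> arcs G. tail G e = v}"
proof -
  have "bij_betw (head G) {e \<in> arcs G. tail G e = v} (out_nbrs G v)"
    unfolding bij_betw_def
  proof
    show "inj_on (head G) {e \<in> arcs G. tail G e = v}"
      by (rule inj_onI) (auto intro: no_multi_arcs simp: arc_to_ends_def)
    show "head G ` {e \<in> arcs G. tail G e = v} = out_nbrs G v"
      by (auto simp: out_nbrs_def arcs_ends_conv image_iff) (metis no_loops)
  qed
  then show ?thesis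
    unfolding out_deg_def by (metis bij_betw_same_card)
qed

text \<open>Without multiple or opposite arcs, an arc is determined by the unordered pair of its
  ends, so the arcs inside \<open>X\<close> inject into the 2-subsets of \<open>X\<close>.\<close>

lemma (in oriented_graph) card_arcs_inside_le:
  assumes "finite X"
  shows "2 * card {e \<in> arcs G. tail G e \<in> X \<and> head G e \<in> X} \<le> card X * (card X - 1)"
proof -
  let ?I = "{e \<in> arcs G. tail G e \<in> X \<and> head G e \<in> X}"
  let ?f = "\<lambda>e. {tail G e, head G e}"
  have "inj_on ?f ?I"
  proof (rule inj_onI)
    fix e e' assume e: "e \<in> ?I" "e' \<in> ?I" "?f e = ?f e'"
    have "tail G e \<rightarrow>\<^bsub>G\<^esub> head G e" "tail G e' \<rightarrow>\<^bsub>G\<^esub> head G e'"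
      using e in_arcs_imp_in_arcs_ends by blast+
    then have "tail G e = tail G e' \<and> head G e = head G e'"
      using e(3) no_opposite_arcs by (metis doubleton_eq_iff)
    then show "e = e'"
      using e by (intro no_multi_arcs) (auto simp: arc_to_ends_def)
  qed
  moreover have "?f ` ?I \<subseteq> {A. A \<subseteq> X \<and> card A = 2}"
    using no_loops by (auto simp: card_insert_if)
  moreover have "finite {A. A \<subseteq> X \<and> card A = 2}"
    using assms by (auto intro: finite_subset[of _ "Pow X"])
  ultimately have "card ?I \<le> card X choose 2"
    unfolding n_subsets[OF assms, symmetric] by (rule card_inj_on_le)
  then show ?thesis
    by (simp add: choose_two)
qed

text \<open>Eliminating \<open>b\<close> by \<open>b \<ge> 2 * p - 1 - a\<close> with weight
  \<open>q\<close> (void for \<open>q = 0\<close>), then \<open>a\<close> by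
  \<open>a \<ge> p\<close> with weight \<open>p - q\<close>, gives
  \<open>2 * L \<ge> 2 * p + (p + q) * (p - q - 1)\<close>, and the last product is nonnegative as
  \<open>q < p\<close>.\<close>

lemma cut_arithmetic:
  fixes p q a b L I :: int
  assumes "0 \<le> q" "q < p" "p \<le> a" "q = 0 \<or> 2 * p \<le> a + b + 1"
    and "p * a + q * b \<le> L + I" "2 * I \<le> (p + q) * (p + q - 1)"
  shows "p \<le> L"
proof -
  have "q * (2 * p - 1 - a) \<le> q * b"
    using assms(1,4) by (auto intro: mult_left_mono)
  moreover have "p * (p - q) \<le> a * (p - q)"
    using assms(2,3) by (intro mult_right_mono) auto
  moreover have "0 \<le> (p + q) * (p - q - 1)"
    using assms(1,2) by simp
  ultimately show ?thesis
    using assms(5,6) by (simp add: algebra_simps)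
qed

theorem theorem2p1:
  fixes D :: "('a, 'b) pre_digraph" and v0 :: 'a and a b :: nat
  assumes "oriented_graph D"
    and "v0 \<in> verts D"
    and "\<And>u. u \<in> verts D - {v0} \<Longrightarrow> (v0 \<rightarrow>\<^bsub>D\<^esub> u) \<noteq> (u \<rightarrow>\<^bsub>D\<^esub> v0)"
    and "a = min_out_deg D (out_nbrs D v0)"
    and "b = min_out_deg D (in_nbrs D v0)"
    and "real (out_deg D v0) \<le> min (real a) (1 / 2 * (real a + real b + 1))"
  shows "\<exists>C. finite C \<and> card C = out_deg D v0
    \<and> (\<forall>p \<in> C. pre_digraph.cycle D p \<and> v0 \<in> cycle_verts D p)
    \<and> pairwise arc_disjoint C"
proof -
  interpret oriented_graph D
    by (rule assms(1))
  let ?k = "out_deg D v0"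
  let ?O = "out_nbrs D v0" and ?N = "in_nbrs D v0"
  have ka: "?k \<le> a" and kab: "2 * ?k \<le> a + b + 1"
    using assms(6) by auto
  have finO: "finite ?O" and finN: "finite ?N"
    by (auto simp: out_nbrs_def in_nbrs_def)
  have a_le: "a \<le> out_deg D v" if "v \<in> ?O" for v
    using that finO unfolding assms(4) min_out_deg_def by simp
  have b_le: "b \<le> out_deg D v" if "v \<in> ?N" for v
    using that finN unfolding assms(5) min_out_deg_def by simp
  have cut: "card {e \<in> arcs D. tail D e = v0 \<and> head D e \<in> X}
      \<le> card {e \<in> arcs D. tail D e \<in> X \<and> head D e \<notin> X}" (is "?s \<le> card ?L")
    if X: "X \<subseteq> verts D - {v0}" for X
  proof -
    let ?p = "card (X \<inter> ?O)" and ?q = "card (X \<inter> ?N)"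
    let ?I = "{e \<in> arcs D. tail D e \<in> X \<and> head D e \<in> X}"
    have finX: "finite X"
      using X finite_verts finite_subset by blast
    \<comment> \<open>Since \<open>v0\<close> is adjacent to every other vertex in exactly one
      direction, \<open>X\<close> splits into out- and in-neighbours.\<close>
    have X_eq: "X = (X \<inter> ?O) \<union> (X \<inter> ?N)" and disj: "(X \<inter> ?O) \<inter> (X \<inter> ?N) = {}"
      using X assms(3) by (auto simp: out_nbrs_def in_nbrs_def)
    have cardX: "card X = ?p + ?q"
      using card_Un_disjoint[OF _ _ disj] finX X_eq by simp
    have "?s \<le> ?p"
    proof (rule card_inj_on_le)
      show "inj_on (head D) {e \<in> arcs D. tail D e = v0 \<and> head D e \<in> X}"
        by (rule inj_onI) (auto intro: no_multi_arcs simp: arc_to_ends_def)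
      show "head D ` {e \<in> arcs D. tail D e = v0 \<and> head D e \<in> X} \<subseteq> X \<inter> ?O"
        using X by (auto simp: out_nbrs_def arcs_ends_conv)
      show "finite (X \<inter> ?O)"
        using finX by simp
    qed
    moreover have "?p \<le> card ?L"
    proof (cases "?q < ?p")
      case False
      \<comment> \<open>Each in-neighbour in \<open>X\<close> has an arc to \<open>v0\<close>, and
        this arc leaves \<open>X\<close> since \<open>v0\<close> lies outside.\<close>
      have "?q \<le> card (tail D ` ?L)"
      proof (rule card_mono)
        show "X \<inter> ?N \<subseteq> tail D ` ?L"
        proof
          fix u assume u: "u \<in> X \<inter> ?N"
          then obtain e where "e \<in> arcs D" "tail D e = u" "head D e = v0"
            by (auto simp: in_nbrs_def)
          then show "u \<in> tail D ` ?L"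
            using u X by (auto intro!: image_eqI[of _ _ e])
        qed
      qed simp
      also have "\<dots> \<le> card ?L"
        by (rule card_image_le) simp
      finally show ?thesis
        using False by simp
    next
      case True
      \<comment> \<open>Here \<open>?O\<close> is nonempty since \<open>?q < ?p\<close>. If
        \<open>?N\<close> is empty, \<open>b\<close> is an unspecified number, but its weight
        \<open>?q\<close> is 0.\<close>
      have "?p * a + ?q * b \<le> (\<Sum>v\<in>X \<inter> ?O. out_deg D v) + (\<Sum>v\<in>X \<inter> ?N. out_deg D v)"
        using sum_bounded_below[of "X \<inter> ?O" a "out_deg D"] sum_bounded_below[of "X \<inter> ?N" b "out_deg D"]
          a_le b_le by (intro add_mono) auto
      also have "\<dots> = (\<Sum>v\<in>X. out_deg D v)"
        using sum.union_disjoint[OF _ _ disj, of "out_deg D"] finX X_eq by simp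
      also have "\<dots> = card {e \<in> arcs D. tail D e \<in> X}"
        using finX by (simp add: out_deg_eq_card_arcs card_filter_mem_eq_sum)
      also have "{e \<in> arcs D. tail D e \<in> X} = ?L \<union> ?I"
        by auto
      also have "card \<dots> = card ?L + card ?I"
        by (rule card_Un_disjoint) auto
      finally have "?p * a + ?q * b \<le> card ?L + card ?I" .
      then have outs: "int ?p * int a + int ?q * int b \<le> int (card ?L) + int (card ?I)"
        by (simp flip: of_nat_mult of_nat_add)
      have "2 * card ?I \<le> (?p + ?q) * (?p + ?q - 1)"
        using card_arcs_inside_le[OF finX] cardX by simp
      then have "int (2 * card ?I) \<le> int ((?p + ?q) * (?p + ?q - 1))"
        by (rule of_nat_mono)
      \<comment> \<open>The truncated subtraction agrees with the integer one because
        \<open>?q < ?p\<close> makes \<open>?p + ?q\<close> positive.\<close>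
      then have ins: "2 * int (card ?I) \<le> (int ?p + int ?q) * (int ?p + int ?q - 1)"
        using True by (simp add: of_nat_diff)
      \<comment> \<open>This brings in the degree hypothesis: \<open>?p \<le> a\<close> and
        \<open>2 * ?p \<le> a + b + 1\<close> follow from the bounds on \<open>?k\<close>.\<close>
      have "?p \<le> ?k"
        unfolding out_deg_def using finO by (intro card_mono) auto
      then have "int ?p \<le> int (card ?L)"
        using True ka kab by (intro cut_arithmetic[OF _ _ _ _ outs ins] disjI2) linarith+
      then show ?thesis
        by simp
    qed
    ultimately show ?thesis
      by simp
  qed
  obtain F where F: "flow F v0 v0" "{e \<in> arcs D. tail D e = v0} \<subseteq> F"
  proof (rule saturating_circulation_exists)
    show "head D e \<noteq> v0" if "e \<in> arcs D" "tail D e = v0" for e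
      using no_loops that by metis
  qed (rule cut)
  then have "{e \<in> F. tail D e = v0} = {e \<in> arcs D. tail D e = v0}"
    by (auto simp: flow_def)
  then have "card {e \<in> F. tail D e = v0} = ?k"
    by (simp add: out_deg_eq_card_arcs)
  from circulation_disjoint_cycles[OF F(1) this] show ?thesis
    by auto
qed

end
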